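(* Let $\mathcal{M}$ be an MDP with reward vector function $\boldsymbol{\rho}=(\rho_1,\ldots,\rho_m)$, let $[\boldsymbol{l},\boldsymbol{u}]\subseteq\mathbb{R}^m$ be a possibly unbounded box, let $\ell:\mathbb{R}^m\to\mathbb{R}$ be a convex function with continuous gradient on $\mathbb{R}^m$, and let $\varepsilon\ge 0$. Consider the Convex Query algorithm (given in the context) run on the input $(\mathcal{M},\boldsymbol{\rho},\boldsymbol{l},\boldsymbol{u},\ell,\varepsilon)$. Then: (1) the algorithm terminates; (2) it returns "infeasible" if and only if $[\![\mathsf{R}_{\boldsymbol{\rho}}]\!]\cap[\boldsymbol{l},\boldsymbol{u}]=\emptyset$; (3) if it returns a point $\overline{\boldsymbol{v}}$ (i.e., $[\![\mathsf{R}_{\boldsymbol{\rho}}]\!]\cap[\boldsymbol{l},\boldsymbol{u}]\neq\emptyset$), then $$\min_{\boldsymbol{x}\in[\![\mathsf{R}_{\boldsymbol{\rho}}]\!]\cap[\boldsymbol{l},\boldsymbol{u}]}\ell(\boldsymbol{x})\;\le\;\ell(\overline{\boldsymbol{v}})\;\le\;\min_{\boldsymbol{x}\in[\![\mathsf{R}_{\boldsymbol{\rho}}]\!]\cap[\boldsymbol{l},\boldsymbol{u}]}\ell(\boldsymbol{x})+\varepsilon .$$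
   Context: **MDPs and total rewards.** An MDP is a tuple $\mathcal{M}=(S',s_0,A',\mathit{prob})$ with (finite) non-empty sets $S'$ of states and $A'$ of actions, an initial state $s_0\in S'$, and $\mathit{prob}:S'\times A'\times S'\to[0,1]$ such that $\sum_{s'\in S'}\mathit{prob}(s,a,s')\in\{0,1\}$ for all $s,a$. The set $A'(s)$ of enabled actions at $s$ consists of those $a$ with $\mathit{prob}(s,a,s')>0$ for some $s'$. A (memoryless) scheduler $\pi$ maps each $s\in S'$ to a probability distribution over $A'(s)$; $\mathit{Sch}(\mathcal{M})$ is the set of all schedulers. A reward function is a map $\rho:S'\times A'\to\mathbb{Q}^+$ (non-negative rationals; the value $0$ is allowed); a reward vector function is a tuple $\boldsymbol{\rho}=(\rho_1,\ldots,\rho_m)$ of reward functions. Under $\pi$, starting from $s_0$, a random trajectory $s_0a_0s_1a_1\ldots$ is generated; the total reward $\mathsf{R}_{\rho}^{\pi}$ is the expected value of $\rho(s_0,a_0)+\rho(s_1,a_1)+\cdots$. It is assumed throughout that these total rewards exist (are finite). Write $\mathsf{R}_{\boldsymbol{\rho}}^{\pi}=(\mathsf{R}_{\rho_1}^{\pi},\ldots,\mathsf{R}_{\rho_m}^{\pi})$ and $$[\![\mathsf{R}_{\boldsymbol{\rho}}]\!]=\{\mathsf{R}_{\boldsymbol{\rho}}^{\pi}\in\mathbb{R}^m\mid \pi\in\mathit{Sch}(\mathcal{M})\}.$$ It is a known fact (recalled from the literature) that $[\![\mathsf{R}_{\boldsymbol{\rho}}]\!]$ is a bounded polytope with finitely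 many faces. **Geometry.** $\boldsymbol{x}\cdot\boldsymbol{y}$ is the dot product, $\|\cdot\|$ the Euclidean norm, $\|\cdot\|_1$ the $1$-norm. The box is $[\boldsymbol{l},\boldsymbol{u}]=[l_1,u_1]\times\cdots\times[l_m,u_m]$, where $l_i=-\infty$ and/or $u_i=+\infty$ is allowed (the interval is then unbounded and open at the infinite end). For a finite set $\Phi\subset\mathbb{R}^m$, $\mathbf{V}(\Phi)$ is the set of convex combinations of points of $\Phi$, with $\mathbf{V}(\emptyset)=\emptyset$. For a finite set $\Lambda$ of pairs $(\boldsymbol{w},\boldsymbol{r})$ (direction, point), $\mathbf{H}(\Lambda)=\{\boldsymbol{x}\in\mathbb{R}^m\mid \boldsymbol{w}\cdot\boldsymbol{r}\ge\boldsymbol{w}\cdot\boldsymbol{x}\text{ for all }(\boldsymbol{w},\boldsymbol{r})\in\Lambda\}$, with $\mathbf{H}(\emptyset)=\mathbb{R}^m$. For a convex set $\Psi$, a direction $\boldsymbol{w}$ and $\boldsymbol{r}\in\Psi$, the set $\{\boldsymbol{y}\mid\boldsymbol{w}\cdot\boldsymbol{y}=\boldsymbol{w}\cdot\boldsymbol{r}\}$ is a supporting hyperplane of $\Psi$ if $\boldsymbol{w}\cdot\boldsymbol{r}\ge\boldsymbol{w}\cdot\boldsymbol{x}$ for all $\boldsymbol{x}\in\Psi$. **Convex Query algorithm.** Input: $\mathcal{M},\boldsymbol{\rho},\boldsymbol{l},\boldsymbol{u},\ell,\varepsilon\ge0$. ($\arg\min$ denotes a minimizer.) Set $\Phi:=\emptyset$,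 $\Lambda:=\emptyset$; initialise $\overline{\boldsymbol{v}},\underline{\boldsymbol{v}}$; choose $\boldsymbol{w}\in\mathbb{R}^m$ with $\|\boldsymbol{w}\|_1=1$. Then repeat forever: 1. Find $\boldsymbol{r}\in[\![\mathsf{R}_{\boldsymbol{\rho}}]\!]$ such that $\{\boldsymbol{y}\mid\boldsymbol{w}\cdot\boldsymbol{y}=\boldsymbol{w}\cdot\boldsymbol{r}\}$ is a supporting hyperplane of $[\![\mathsf{R}_{\boldsymbol{\rho}}]\!]$. 2. $\Phi:=\Phi\cup\{\boldsymbol{r}\}$; $\Lambda:=\Lambda\cup\{(\boldsymbol{w},\boldsymbol{r})\}$. 3. If $\mathbf{H}(\Lambda)\cap[\boldsymbol{l},\boldsymbol{u}]=\emptyset$, return "infeasible" (and stop). 4. If $|\Lambda|=1$ or $\boldsymbol{w}\cdot\boldsymbol{r}<\boldsymbol{w}\cdot\underline{\boldsymbol{v}}$, set $\underline{\boldsymbol{v}}:=\arg\min_{\boldsymbol{z}\in\mathbf{H}(\Lambda)\cap[\boldsymbol{l},\boldsymbol{u}]}\ell(\boldsymbol{z})$. 5. Set $\overline{\boldsymbol{v}}:=\arg\min_{\boldsymbol{x}\in\mathbf{V}(\Phi)}\|\underline{\boldsymbol{v}}-\boldsymbol{x}\|$. 6. If $\overline{\boldsymbol{v}}\in[\boldsymbol{l},\boldsymbol{u}]$ and $\ell(\overline{\boldsymbol{v}})-\ell(\underline{\boldsymbol{v}})\le\varepsilon$, return $\overline{\boldsymbol{v}}$ (and stop). 7. Set 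$\boldsymbol{w}:=(\underline{\boldsymbol{v}}-\overline{\boldsymbol{v}})/\|\underline{\boldsymbol{v}}-\overline{\boldsymbol{v}}\|_1$.
   Formalization: It is assumed that whenever the run evaluates the arg min in step 4, a minimizer exists (it may fail for an unbounded box, e.g. ℓ(x) = −x on ℝ), and the recalled fact that [[R_ρ]] is a polytope is taken as a hypothesis, since it can fail for memoryless schedulers. *)

theory Defs
  imports "HOL-Probability.Probability"
begin

section \<open>Markov decision processes and expected total rewards\<close>

text \<open>The finite non-empty sets of states and actions are the universes of two finite types
  (the class constraint \<open>finite\<close> appears where it is needed).\<close>

record ('s, 'a) mdp =
  init :: 's
  prob :: "'s \<Rightarrow> 'a \<Rightarrow> 's \<Rightarrow> real"

definition is_mdp :: "('s::finite, 'a::finite) mdp \<Rightarrow> bool" where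
  "is_mdp M \<longleftrightarrow>
     (\<forall>s a s'. 0 \<le> prob M s a s' \<and> prob M s a s' \<le> 1) \<and>
     (\<forall>s a. (\<Sum>s'\<in>UNIV. prob M s a s') \<in> {0, 1})"

definition enabled :: "('s, 'a) mdp \<Rightarrow> 's \<Rightarrow> 'a set" where
  "enabled M s = {a. \<exists>s'. prob M s a s' > 0}"

text \<open>The definition of an MDP does not exclude states without enabled actions, on which there is no
  distribution over the enabled actions. They are terminal here: the value of a scheduler on
  such a state is irrelevant, the trajectory ends there and collects no further reward. If every
  state has an enabled action, this is literally the set of memoryless schedulers.\<close>

definition schedulers :: "('s, 'a) mdp \<Rightarrow> ('s \<Rightarrow> 'a pmf) set" where
  "schedulers M = {\<pi>. \<forall>s. enabled M s \<noteq> {} \<longrightarrow> set_pmf (\<pi> s) \<subseteq> enabled M s}"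

text \<open>To keep all trajectories infinite, one that has reached a terminal state is padded by
  repeating that state.\<close>

definition successor :: "('s, 'a) mdp \<Rightarrow> 's \<Rightarrow> 'a \<Rightarrow> 's pmf" where
  "successor M s a = (if a \<in> enabled M s then embed_pmf (prob M s a) else return_pmf s)"

definition step_reward :: "('s, 'a) mdp \<Rightarrow> ('s \<Rightarrow> 'a \<Rightarrow> rat) \<Rightarrow> 's \<times> 'a \<Rightarrow> real" where
  "step_reward M \<rho> = (\<lambda>(s, a). if a \<in> enabled M s then of_rat (\<rho> s a) else 0)"

text \<open>The law of the \<open>n\<close>-th state-action pair given the earlier ones.\<close>

definition kernel ::
    "('s, 'a) mdp \<Rightarrow> ('s \<Rightarrow> 'a pmf) \<Rightarrow> nat \<Rightarrow> (nat \<Rightarrow> 's \<times> 'a) \<Rightarrow> ('s \<times> 'a) measure" where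
  "kernel M \<pi> n \<omega> = measure_pmf
     (bind_pmf (case n of 0 \<Rightarrow> return_pmf (init M)
                        | Suc k \<Rightarrow> successor M (fst (\<omega> k)) (snd (\<omega> k)))
       (\<lambda>s. map_pmf (Pair s) (\<pi> s)))"

text \<open>The probability measure on trajectories: the Ionescu-Tulcea extension of the kernels.\<close>

definition trajectories ::
    "('s, 'a) mdp \<Rightarrow> ('s \<Rightarrow> 'a pmf) \<Rightarrow> (nat \<Rightarrow> 's \<times> 'a) measure" where
  "trajectories M \<pi> =
     projective_family.lim UNIV
       (Ionescu_Tulcea.CI (kernel M \<pi>) (\<lambda>_. count_space UNIV)) (\<lambda>_. count_space UNIV)"

lemma Ionescu_Tulcea_kernel:
  fixes M :: "('s::finite, 'a::finite) mdp"
  shows "Ionescu_Tulcea (kernel M \<pi>) (\<lambda>_. count_space UNIV)"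
proof (rule Ionescu_Tulcea.intro)
  show "kernel M \<pi> i \<in> measurable (PiM {0..<i} (\<lambda>_. count_space UNIV))
          (subprob_algebra (count_space UNIV))" for i
  proof (cases i)
    case 0
    then show ?thesis
      by (auto simp: kernel_def[abs_def] space_subprob_algebra
          intro!: measurable_const prob_space_imp_subprob_space measure_pmf.prob_space_axioms)
  next
    case (Suc k)
    define g where "g = (\<lambda>x. measure_pmf (bind_pmf (successor M (fst x) (snd x))
       (\<lambda>s. map_pmf (Pair s) (\<pi> s))))"
    have "g \<in> measurable (count_space UNIV) (subprob_algebra (count_space UNIV))"
      by (auto simp: g_def space_subprob_algebra
          intro!: prob_space_imp_subprob_space measure_pmf.prob_space_axioms)
    moreover have "(\<lambda>\<omega>. \<omega> k) \<in> measurable (PiM {0..<i} (\<lambda>_. count_space UNIV))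
          (count_space (UNIV :: ('s \<times> 'a) set))"
      by (rule measurable_component_singleton) (simp add: Suc)
    ultimately have "(\<lambda>\<omega>. g (\<omega> k)) \<in> measurable (PiM {0..<i} (\<lambda>_. count_space UNIV))
          (subprob_algebra (count_space UNIV))"
      by (rule measurable_compose[rotated])
    then show ?thesis
      by (simp add: kernel_def[abs_def] g_def Suc)
  qed
  show "prob_space (kernel M \<pi> i x)" for i x
    by (simp add: kernel_def measure_pmf.prob_space_axioms)
qed

definition total_reward ::
    "('s, 'a) mdp \<Rightarrow> ('s \<Rightarrow> 'a \<Rightarrow> rat) \<Rightarrow> ('s \<Rightarrow> 'a pmf) \<Rightarrow> ennreal" where
  "total_reward M \<rho> \<pi> =
     (\<integral>\<^sup>+ \<omega>. (\<Sum>n. ennreal (step_reward M \<rho> (\<omega> n))) \<partial>trajectories M \<pi>)"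

definition achievable ::
    "('s, 'a) mdp \<Rightarrow> ('m::finite \<Rightarrow> 's \<Rightarrow> 'a \<Rightarrow> rat) \<Rightarrow> (real ^ 'm) set" where
  "achievable M \<rho> = {(\<chi> i. enn2real (total_reward M (\<rho> i) \<pi>)) | \<pi>. \<pi> \<in> schedulers M}"


section \<open>Geometry\<close>

definition norm1 :: "real ^ 'm::finite \<Rightarrow> real" where
  "norm1 x = (\<Sum>i\<in>UNIV. \<bar>x $ i\<bar>)"

definition ebox :: "ereal ^ 'm::finite \<Rightarrow> ereal ^ 'm \<Rightarrow> (real ^ 'm) set" where
  "ebox l u = {x. \<forall>i. l $ i \<le> ereal (x $ i) \<and> ereal (x $ i) \<le> u $ i}"

definition halfspaces :: "((real ^ 'm::finite) \<times> (real ^ 'm)) set \<Rightarrow> (real ^ 'm) set" where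
  "halfspaces \<Lambda> = {x. \<forall>(w, r)\<in>\<Lambda>. w \<bullet> r \<ge> w \<bullet> x}"

text \<open>Says that the hyperplane through \<open>r \<in> \<Psi>\<close> with normal \<open>w\<close> supports \<open>\<Psi>\<close>.\<close>

definition supports :: "(real ^ 'm::finite) set \<Rightarrow> real ^ 'm \<Rightarrow> real ^ 'm \<Rightarrow> bool" where
  "supports \<Psi> w r \<longleftrightarrow> (\<forall>x\<in>\<Psi>. w \<bullet> r \<ge> w \<bullet> x)"


section \<open>The convex query algorithm\<close>

text \<open>
  The algorithm is nondeterministic (choice of the initial values, of \<open>r\<close>, and of minimizers), so it
  is a transition relation. \<open>Query \<Phi> \<Lambda> vu vl w\<close> is the head of the loop and
  \<open>Refine \<Phi> \<Lambda> vu vl w r\<close> the point right after the supporting point \<open>r\<close> for \<open>w\<close> has been added to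
  \<open>\<Phi>\<close> and \<open>\<Lambda>\<close>; \<open>vu\<close> and \<open>vl\<close> are the overlined and the underlined \<open>v\<close>.
\<close>

datatype 'v config =
    Query "'v set" "('v \<times> 'v) set" 'v 'v 'v
  | Refine "'v set" "('v \<times> 'v) set" 'v 'v 'v 'v
  | Infeasible
  | Solution 'v

definition initial :: "(real ^ 'm::finite) config \<Rightarrow> bool" where
  "initial c \<longleftrightarrow> (\<exists>vu vl w. norm1 w = 1 \<and> c = Query {} {} vu vl w)"

text \<open>The condition under which \<open>vl\<close> is recomputed.\<close>

definition needs_minimizer ::
    "((real ^ 'm::finite) \<times> (real ^ 'm)) set \<Rightarrow> real ^ 'm \<Rightarrow> real ^ 'm \<Rightarrow> real ^ 'm \<Rightarrow> bool" where
  "needs_minimizer \<Lambda> vl w r \<longleftrightarrow> card \<Lambda> = 1 \<or> w \<bullet> r < w \<bullet> vl"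

text \<open>\<open>vl'\<close> and \<open>vu'\<close> are possible values of \<open>vl\<close> and \<open>vu\<close> after their update. There are none, and
  the algorithm is stuck, if a minimizer of \<open>f\<close> is required but does not exist.\<close>

definition new_points ::
    "(real ^ 'm::finite) set \<Rightarrow> (real ^ 'm \<Rightarrow> real) \<Rightarrow> (real ^ 'm) set \<Rightarrow>
     ((real ^ 'm) \<times> (real ^ 'm)) set \<Rightarrow> real ^ 'm \<Rightarrow> real ^ 'm \<Rightarrow> real ^ 'm \<Rightarrow>
     real ^ 'm \<Rightarrow> real ^ 'm \<Rightarrow> bool" where
  "new_points B f \<Phi> \<Lambda> vl w r vl' vu' \<longleftrightarrow>
     (if needs_minimizer \<Lambda> vl w r then is_arg_min f (\<lambda>z. z \<in> halfspaces \<Lambda> \<inter> B) vl'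
      else vl' = vl) \<and>
     is_arg_min (\<lambda>x. norm (vl' - x)) (\<lambda>x. x \<in> convex hull \<Phi>) vu'"

inductive cq_step ::
    "(real ^ 'm::finite) set \<Rightarrow> (real ^ 'm) set \<Rightarrow> (real ^ 'm \<Rightarrow> real) \<Rightarrow> real \<Rightarrow>
     (real ^ 'm) config \<Rightarrow> (real ^ 'm) config \<Rightarrow> bool"
  for R B f \<epsilon> where
  query: "r \<in> R \<Longrightarrow> supports R w r \<Longrightarrow>
    cq_step R B f \<epsilon> (Query \<Phi> \<Lambda> vu vl w)
      (Refine (\<Phi> \<union> {r}) (\<Lambda> \<union> {(w, r)}) vu vl w r)"
| infeasible: "halfspaces \<Lambda> \<inter> B = {} \<Longrightarrow>
    cq_step R B f \<epsilon> (Refine \<Phi> \<Lambda> vu vl w r) Infeasible"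
| solution: "halfspaces \<Lambda> \<inter> B \<noteq> {} \<Longrightarrow> new_points B f \<Phi> \<Lambda> vl w r vl' vu' \<Longrightarrow>
    vu' \<in> B \<and> f vu' - f vl' \<le> \<epsilon> \<Longrightarrow>
    cq_step R B f \<epsilon> (Refine \<Phi> \<Lambda> vu vl w r) (Solution vu')"
| continue: "halfspaces \<Lambda> \<inter> B \<noteq> {} \<Longrightarrow> new_points B f \<Phi> \<Lambda> vl w r vl' vu' \<Longrightarrow>
    \<not> (vu' \<in> B \<and> f vu' - f vl' \<le> \<epsilon>) \<Longrightarrow>
    cq_step R B f \<epsilon> (Refine \<Phi> \<Lambda> vu vl w r)
      (Query \<Phi> \<Lambda> vu' vl' ((vl' - vu') /\<^sub>R norm1 (vl' - vu')))"

text \<open>Maximal runs: a configuration is repeated only if no step is possible, that is, if the algorithm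
  has stopped or is stuck.\<close>

definition cq_run ::
    "(real ^ 'm::finite) set \<Rightarrow> (real ^ 'm) set \<Rightarrow> (real ^ 'm \<Rightarrow> real) \<Rightarrow> real \<Rightarrow>
     (nat \<Rightarrow> (real ^ 'm) config) \<Rightarrow> bool" where
  "cq_run R B f \<epsilon> c \<longleftrightarrow> initial (c 0) \<and>
     (\<forall>n. cq_step R B f \<epsilon> (c n) (c (Suc n)) \<or>
          (\<nexists>c'. cq_step R B f \<epsilon> (c n) c') \<and> c (Suc n) = c n)"

text \<open>Whenever the run has to recompute \<open>vl\<close>, the required minimizer exists. This can fail for an
  unbounded box, e.g. for a linear \<open>f\<close>. The minimizer that defines \<open>vu\<close> always exists.\<close>

definition minimizers_exist ::
    "(real ^ 'm::finite) set \<Rightarrow> (real ^ 'm \<Rightarrow> real) \<Rightarrow> (nat \<Rightarrow> (real ^ 'm) config) \<Rightarrow> bool" where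
  "minimizers_exist B f c \<longleftrightarrow>
     (\<forall>n \<Phi> \<Lambda> vu vl w r. c n = Refine \<Phi> \<Lambda> vu vl w r \<longrightarrow> halfspaces \<Lambda> \<inter> B \<noteq> {} \<longrightarrow>
        needs_minimizer \<Lambda> vl w r \<longrightarrow> (\<exists>z. is_arg_min f (\<lambda>z. z \<in> halfspaces \<Lambda> \<inter> B) z))"

end

theory Submission
  imports Defs
begin

text \<open>
  For each iteration consider the face of \<open>R = achievable M \<rho>\<close> that is maximal in direction \<open>w\<close>. As
  \<open>R\<close> has finitely many faces, in an infinite run some face \<open>F\<close> recurs infinitely often. If \<open>F\<close> is
  maximal for iterations \<open>j < k\<close>, then the old support point \<open>r\<^sub>j\<close> is a point of the hull that is
  maximal in direction \<open>w\<^sub>k\<close>; hence so is the projection \<open>vu\<^sub>k\<close>, that is, \<open>vu\<^sub>k \<in> F\<close>. Since \<open>vl\<^sub>k\<close> lies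
  in the half-space of iteration \<open>j\<close>, whose boundary contains \<open>F\<close>, it follows that \<open>w\<^sub>j \<bullet> w\<^sub>k \<le> 0\<close>.
  By compactness of the sphere, no infinite sequence of unit vectors has this property.
\<close>

section \<open>Acute pairs in infinite sequences of vectors\<close>

text \<open>A convergent subsequence on the compact sphere has two members at distance below 1, and
  for unit vectors this forces an inner product above 1/2.\<close>

lemma exists_acute_pair:
  fixes u :: "nat \<Rightarrow> 'v::euclidean_space"
  assumes "\<And>n. norm (u n) = 1"
  shows "\<exists>j k. j < k \<and> u j \<bullet> u k > 0"
proof -
  have "seq_compact (sphere (0::'v) 1)"
    by (simp add: compact_eq_seq_compact_metric[symmetric])
  then obtain a r where "strict_mono r" "(u \<circ> r) \<longlonglongrightarrow> a"
    using assms unfolding seq_compact_def by (metis mem_sphere_0)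
  then have "Cauchy (u \<circ> r)"
    by (simp add: LIMSEQ_imp_Cauchy)
  then obtain N where N: "\<And>m n. m \<ge> N \<Longrightarrow> n \<ge> N \<Longrightarrow> dist ((u \<circ> r) m) ((u \<circ> r) n) < 1"
    by (meson metric_CauchyD zero_less_one)
  define j k where "j = r N" and "k = r (Suc N)"
  have "j < k"
    using \<open>strict_mono r\<close> by (simp add: j_def k_def strict_mono_def)
  have "norm (u j - u k) < 1"
    using N[of N "Suc N"] by (simp add: dist_norm j_def k_def)
  then have "(norm (u j - u k))\<^sup>2 < 1"
    by (simp add: power_less_one_iff)
  moreover have "(norm (u j - u k))\<^sup>2 = (norm (u j))\<^sup>2 + (norm (u k))\<^sup>2 - 2 * (u j \<bullet> u k)"
    by (simp add: power2_norm_eq_inner inner_diff inner_commute)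
  ultimately have "u j \<bullet> u k > 0"
    using assms by simp
  with \<open>j < k\<close> show ?thesis
    by blast
qed

text \<open>Reduces to unit vectors: \<open>sgn\<close> rescales by a positive factor, so signs of
  inner products are kept, and \<open>enumerate\<close> preserves the order of indices.\<close>

lemma infinite_exists_acute_pair:
  fixes w :: "nat \<Rightarrow> 'v::euclidean_space"
  assumes "infinite K" and "\<And>k. k \<in> K \<Longrightarrow> w k \<noteq> 0"
  shows "\<exists>j\<in>K. \<exists>k\<in>K. j < k \<and> w j \<bullet> w k > 0"
proof -
  define u where "u n = sgn (w (enumerate K n))" for n
  have K: "enumerate K n \<in> K" for n
    by (rule enumerate_in_set[OF assms(1)])
  have "norm (u n) = 1" for n
    using assms(2)[OF K] by (simp add: u_def norm_sgn)
  then obtain j k where "j < k" and *: "u j \<bullet> u k > 0"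
    using exists_acute_pair[of u] by blast
  have "w (enumerate K j) \<bullet> w (enumerate K k) > 0"
    using * assms(2)[OF K] by (simp add: u_def sgn_div_norm zero_less_mult_iff)
  moreover have "enumerate K j < enumerate K k"
    using \<open>j < k\<close> by (simp add: assms(1))
  ultimately show ?thesis
    using K by blast
qed

section \<open>Projections, minimizers and supporting half-spaces\<close>

text \<open>Obtuse-angle criterion for projections; it makes \<open>vu\<close> maximal over the hull
  in the direction of the next query.\<close>

lemma is_arg_min_norm_inner_le:
  fixes p :: "'v::euclidean_space"
  assumes "is_arg_min (\<lambda>x. norm (p - x)) (\<lambda>x. x \<in> S) q"
    and "convex S" "closed S" "x \<in> S"
  shows "(p - q) \<bullet> x \<le> (p - q) \<bullet> q"
proof -
  have "(p - q) \<bullet> (x - q) \<le> 0"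
    using assms by (intro any_closest_point_dot[of S]) (auto simp: is_arg_min_linorder dist_norm)
  then show ?thesis
    by (simp add: inner_diff_right)
qed

lemma compact_is_arg_min_exists:
  fixes f :: "'v::topological_space \<Rightarrow> real"
  assumes "compact S" "S \<noteq> {}" "continuous_on S f"
  shows "\<exists>x. is_arg_min f (\<lambda>x. x \<in> S) x"
  using continuous_attains_inf[OF assms] by (auto simp: is_arg_min_linorder)

lemma norm1_eq_0_iff: "norm1 x = 0 \<longleftrightarrow> x = 0"
  by (auto simp: norm1_def sum_nonneg_eq_0_iff vec_eq_iff)

lemma norm1_nonneg: "norm1 x \<ge> 0"
  by (simp add: norm1_def sum_nonneg)

lemma closed_ebox: "closed (ebox l u)"
  unfolding ebox_def
  by (intro closed_Collect_all closed_Collect_conj closed_Collect_le continuous_intros)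

lemma schedulers_nonempty: "schedulers M \<noteq> {}"
proof -
  \<comment> \<open>At a terminal state \<open>SOME\<close> yields an arbitrary action, which
    \<open>schedulers\<close> permits.\<close>
  have "(\<lambda>s. return_pmf (SOME a. a \<in> enabled M s)) \<in> schedulers M"
    by (auto simp: schedulers_def intro: someI)
  then show ?thesis
    by blast
qed

lemma achievable_nonempty: "achievable M \<rho> \<noteq> {}"
  using schedulers_nonempty[of M] by (auto simp: achievable_def)

text \<open>This outer approximation makes the answer \<open>Infeasible\<close> sound and turns
  minima over \<open>halfspaces \<Lambda> \<inter> B\<close> into lower bounds on
  \<open>R \<inter> B\<close>.\<close>

lemma supports_imp_subset_halfspaces:
  "\<forall>(w, r)\<in>\<Lambda>. supports R w r \<Longrightarrow> R \<subseteq> halfspaces \<Lambda>"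
  by (fastforce simp: halfspaces_def supports_def)

lemma supporting_point_exists:
  assumes "compact R" "R \<noteq> {}"
  shows "\<exists>r\<in>R. supports R w r"
  using continuous_attains_sup[OF assms, of "\<lambda>x. w \<bullet> x"]
  by (auto simp: supports_def continuous_on_inner)

section \<open>Loop invariant and progress of the algorithm\<close>

text \<open>At the first loop head \<open>vu\<close> and \<open>vl\<close> are arbitrary, hence the
  guard \<open>\<Lambda> \<noteq> {}\<close>. Within an iteration \<open>vl\<close> is known to be
  optimal only for the constraints \<open>\<Lambda>'\<close> before the insertion; for
  \<open>card \<Lambda> = 1\<close> nothing is asked of it, as it is then recomputed. The two final
  configurations carry the correctness claims.\<close>

fun cq_invariant ::
    "(real ^ 'm::finite) set \<Rightarrow> (real ^ 'm) set \<Rightarrow> (real ^ 'm \<Rightarrow> real) \<Rightarrow> real \<Rightarrow>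
     (real ^ 'm) config \<Rightarrow> bool" where
  "cq_invariant R B f \<epsilon> (Query \<Phi> \<Lambda> vu vl w) \<longleftrightarrow>
     finite \<Phi> \<and> \<Phi> \<subseteq> R \<and> (\<forall>(w, r)\<in>\<Lambda>. supports R w r) \<and>
     (\<Lambda> \<noteq> {} \<longrightarrow>
        is_arg_min f (\<lambda>z. z \<in> halfspaces \<Lambda> \<inter> B) vl \<and>
        is_arg_min (\<lambda>x. norm (vl - x)) (\<lambda>x. x \<in> convex hull \<Phi>) vu \<and>
        vl \<noteq> vu \<and> w = (vl - vu) /\<^sub>R norm1 (vl - vu))"
| "cq_invariant R B f \<epsilon> (Refine \<Phi> \<Lambda> vu vl w r) \<longleftrightarrow>
     finite \<Phi> \<and> \<Phi> \<noteq> {} \<and> \<Phi> \<subseteq> R \<and> \<Lambda> \<noteq> {} \<and> (\<forall>(w, r)\<in>\<Lambda>. supports R w r) \<and>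
     (card \<Lambda> \<noteq> 1 \<longrightarrow>
        (\<exists>\<Lambda>'. \<Lambda> = insert (w, r) \<Lambda>' \<and> is_arg_min f (\<lambda>z. z \<in> halfspaces \<Lambda>' \<inter> B) vl))"
| "cq_invariant R B f \<epsilon> Infeasible \<longleftrightarrow> R \<inter> B = {}"
| "cq_invariant R B f \<epsilon> (Solution v) \<longleftrightarrow> v \<in> R \<inter> B \<and> (\<forall>x\<in>R \<inter> B. f v \<le> f x + \<epsilon>)"

text \<open>Skipping the recomputation is harmless: the old \<open>vl\<close> then satisfies the new
  constraint, and a minimizer over a larger set stays one over any subset that contains it.\<close>

lemma new_points_is_arg_min:
  assumes "cq_invariant R B f \<epsilon> (Refine \<Phi> \<Lambda> vu vl w r)"
    and "new_points B f \<Phi> \<Lambda> vl w r vl' vu'"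
  shows "is_arg_min f (\<lambda>z. z \<in> halfspaces \<Lambda> \<inter> B) vl'"
proof (cases "needs_minimizer \<Lambda> vl w r")
  case True
  with assms(2) show ?thesis
    by (simp add: new_points_def)
next
  case False
  then obtain \<Lambda>' where "\<Lambda> = insert (w, r) \<Lambda>'"
    and "is_arg_min f (\<lambda>z. z \<in> halfspaces \<Lambda>' \<inter> B) vl" and "w \<bullet> vl \<le> w \<bullet> r" and "vl' = vl"
    using assms by (auto simp: needs_minimizer_def new_points_def)
  then show ?thesis
    by (auto simp: is_arg_min_linorder halfspaces_def)
qed

lemma cq_invariant_step:
  assumes "convex R" "\<epsilon> \<ge> 0"
    and "cq_step R B f \<epsilon> c c'" "cq_invariant R B f \<epsilon> c"
  shows "cq_invariant R B f \<epsilon> c'"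
  using assms(3,4)
proof cases
  case (query r w \<Phi> \<Lambda> vu vl)
  \<comment> \<open>If \<open>\<Lambda>\<close> is empty, the new set is a singleton; otherwise the
    old \<open>\<Lambda>\<close> is the witness for \<open>\<Lambda>'\<close>.\<close>
  with assms(4) show ?thesis
    by (cases "\<Lambda> = {}") auto
next
  case (infeasible \<Lambda> \<Phi> vu vl w r)
  with assms(4) show ?thesis
    using supports_imp_subset_halfspaces[of \<Lambda> R] by auto
next
  case (solution \<Lambda> \<Phi> vl w r vl' vu' vu)
  have "R \<subseteq> halfspaces \<Lambda>" "\<Phi> \<subseteq> R"
    using assms(4) solution(1) supports_imp_subset_halfspaces[of \<Lambda> R] by auto
  moreover have "is_arg_min f (\<lambda>z. z \<in> halfspaces \<Lambda> \<inter> B) vl'"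
    using new_points_is_arg_min assms(4) solution by blast
  moreover have "vu' \<in> convex hull \<Phi>"
    using solution by (simp add: new_points_def is_arg_min_def)
  moreover have "convex hull \<Phi> \<subseteq> R"
    using \<open>\<Phi> \<subseteq> R\<close> assms(1) by (rule hull_minimal)
  \<comment> \<open>On \<open>R \<inter> B\<close> the value \<open>f vl'\<close> is a lower bound,
    and the stopping test puts \<open>f vu'\<close> at most \<open>\<epsilon>\<close> above
    it.\<close>
  ultimately show ?thesis
    using solution by (fastforce simp: is_arg_min_linorder)
next
  case (continue \<Lambda> \<Phi> vl w r vl' vu' vu)
  have vl': "is_arg_min f (\<lambda>z. z \<in> halfspaces \<Lambda> \<inter> B) vl'"
    using new_points_is_arg_min assms(4) continue by blast
  \<comment> \<open>Otherwise \<open>vu'\<close> would lie in \<open>B\<close> with gap 0 \<le>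
    \<epsilon>, and the algorithm would have stopped.\<close>
  then have "vl' \<noteq> vu'"
    using continue assms(2) by (auto simp: is_arg_min_def)
  with vl' show ?thesis
    using assms(4) continue by (auto simp: new_points_def)
qed

text \<open>Compactness of \<open>R\<close> supplies the supporting point, and compactness of the
  hull of the finite set \<open>\<Phi>\<close> supplies the projection, so only a missing minimizer
  of \<open>f\<close> could block a step.\<close>

lemma cq_step_exists:
  assumes "compact R" "R \<noteq> {}"
    and "cq_invariant R B f \<epsilon> c" "c \<noteq> Infeasible" "\<And>v. c \<noteq> Solution v"
    and minimizer: "\<And>\<Phi> \<Lambda> vu vl w r. c = Refine \<Phi> \<Lambda> vu vl w r \<Longrightarrow> halfspaces \<Lambda> \<inter> B \<noteq> {} \<Longrightarrow>
      needs_minimizer \<Lambda> vl w r \<Longrightarrow> \<exists>z. is_arg_min f (\<lambda>z. z \<in> halfspaces \<Lambda> \<inter> B) z"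
  shows "\<exists>c'. cq_step R B f \<epsilon> c c'"
proof (cases c)
  case (Query \<Phi> \<Lambda> vu vl w)
  then show ?thesis
    using supporting_point_exists[OF assms(1,2)] cq_step.query by blast
next
  case (Refine \<Phi> \<Lambda> vu vl w r)
  show ?thesis
  proof (cases "halfspaces \<Lambda> \<inter> B = {}")
    case True
    then show ?thesis
      using Refine cq_step.infeasible by blast
  next
    case False
    obtain vl' where vl': "if needs_minimizer \<Lambda> vl w r
        then is_arg_min f (\<lambda>z. z \<in> halfspaces \<Lambda> \<inter> B) vl' else vl' = vl"
      using minimizer[OF Refine False] by (cases "needs_minimizer \<Lambda> vl w r") auto
    have "compact (convex hull \<Phi>)" "convex hull \<Phi> \<noteq> {}"
      using assms(3) Refine by (auto intro: finite_imp_compact_convex_hull)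
    then obtain vu' where "is_arg_min (\<lambda>x. norm (vl' - x)) (\<lambda>x. x \<in> convex hull \<Phi>) vu'"
      using compact_is_arg_min_exists[of "convex hull \<Phi>" "\<lambda>x. norm (vl' - x)"]
      by (auto simp: continuous_on_norm continuous_on_diff)
    with vl' have "new_points B f \<Phi> \<Lambda> vl w r vl' vu'"
      by (simp add: new_points_def)
    with False show ?thesis
      unfolding Refine by (meson cq_step.solution cq_step.continue)
  qed
qed (use assms in auto)

lemma cq_invariant_run:
  assumes "convex R" "\<epsilon> \<ge> 0" "cq_run R B f \<epsilon> c"
  shows "cq_invariant R B f \<epsilon> (c n)"
proof (induction n)
  case 0
  show ?case
    using assms(3) by (auto simp: cq_run_def initial_def)
next
  case (Suc n)
  then show ?case
    using assms cq_invariant_step unfolding cq_run_def by metis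
qed

section \<open>Termination\<close>

text \<open>The primed pair comes from an earlier iteration. Its membership in
  \<open>\<Lambda>\<close> also makes the guarded part of the invariant available.\<close>

lemma same_face_imp_not_acute:
  assumes "cq_invariant R B f \<epsilon> (Query \<Phi> \<Lambda> vu vl w)"
    and "convex R" "r' \<in> \<Phi>" "(w', r') \<in> \<Lambda>" "supports R w r"
    and same_face: "R \<inter> {x. w' \<bullet> x = w' \<bullet> r'} = R \<inter> {x. w \<bullet> x = w \<bullet> r}"
  shows "w \<noteq> 0" and "w' \<bullet> w \<le> 0"
proof -
  define t where "t = inverse (norm1 (vl - vu))"
  have inv: "finite \<Phi>" "\<Phi> \<subseteq> R" "is_arg_min f (\<lambda>z. z \<in> halfspaces \<Lambda> \<inter> B) vl"
    "is_arg_min (\<lambda>x. norm (vl - x)) (\<lambda>x. x \<in> convex hull \<Phi>) vu"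
    "vl \<noteq> vu" and w: "w = t *\<^sub>R (vl - vu)"
    using assms by (auto simp: t_def)
  have "norm1 (vl - vu) > 0"
    using inv(5) norm1_eq_0_iff[of "vl - vu"] norm1_nonneg[of "vl - vu"] by simp
  then have "t > 0"
    by (simp add: t_def)
  then show "w \<noteq> 0"
    using inv(5) w by simp
  have "(vl - vu) \<bullet> r' \<le> (vl - vu) \<bullet> vu"
    using inv assms(3)
    by (intro is_arg_min_norm_inner_le[of vl "convex hull \<Phi>"])
       (auto intro: hull_inc compact_imp_closed finite_imp_compact_convex_hull)
  then have "w \<bullet> r' \<le> w \<bullet> vu"
    using \<open>t > 0\<close> by (simp add: w)
  moreover have "vu \<in> R"
    using inv(4) hull_minimal[of \<Phi> R convex] inv(2) assms(2) by (auto simp: is_arg_min_def)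
  moreover have "w \<bullet> r' = w \<bullet> r"
    using same_face assms(3) inv(2) by blast
  \<comment> \<open>A squeeze: the projection gives at least
    \<open>w \<bullet> r' = w \<bullet> r\<close>, the support property at most
    \<open>w \<bullet> r\<close>.\<close>
  ultimately have "w \<bullet> vu = w \<bullet> r"
    using assms(5) by (force simp: supports_def)
  then have "w' \<bullet> vu = w' \<bullet> r'"
    using same_face \<open>vu \<in> R\<close> by blast
  moreover have "w' \<bullet> vl \<le> w' \<bullet> r'"
    using inv(3) assms(4) by (auto simp: is_arg_min_def halfspaces_def)
  ultimately have "w' \<bullet> (vl - vu) \<le> 0"
    by (simp add: inner_diff_right)
  then show "w' \<bullet> w \<le> 0"
    using \<open>t > 0\<close> by (simp add: w mult_le_0_iff)
qed

lemma no_infinite_execution: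
  assumes "polytope R" "\<epsilon> \<ge> 0" "initial (c 0)"
    and step: "\<And>n. cq_step R B f \<epsilon> (c n) (c (Suc n))"
  shows False
proof -
  have "convex R"
    using assms(1) by (rule polytope_imp_convex)
  have inv: "cq_invariant R B f \<epsilon> (c n)" for n
    using assms cq_invariant_run[OF \<open>convex R\<close>] by (simp add: cq_run_def)
  \<comment> \<open>One iteration takes two steps, so loop heads sit at even positions; final
    configurations have no successor and hence never occur.\<close>
  have "\<exists>\<Phi> \<Lambda> vu vl w. c (2 * k) = Query \<Phi> \<Lambda> vu vl w" for k
  proof (induction k)
    case 0
    then show ?case
      using assms(3) by (auto simp: initial_def)
  next
    case (Suc k)
    then obtain \<Phi> \<Lambda> vu vl w where "c (2 * k) = Query \<Phi> \<Lambda> vu vl w"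
      by blast
    then obtain \<Phi>' \<Lambda>' vu' vl' w' r' where "c (Suc (2 * k)) = Refine \<Phi>' \<Lambda>' vu' vl' w' r'"
      using step[of "2 * k"] by (auto elim: cq_step.cases)
    moreover have "\<not> cq_step R B f \<epsilon> Infeasible c'" "\<not> cq_step R B f \<epsilon> (Solution v) c'" for c' v
      by (auto elim: cq_step.cases)
    then have "c (Suc (Suc (2 * k))) \<noteq> Infeasible" "c (Suc (Suc (2 * k))) \<noteq> Solution v" for v
      using step[of "Suc (Suc (2 * k))"] by metis+
    ultimately show ?case
      using step[of "Suc (2 * k)"] by (cases "c (Suc (Suc (2 * k)))") (auto elim: cq_step.cases)
  qed
  then obtain \<Phi> \<Lambda> vu vl w where
    query: "\<And>k. c (2 * k) = Query (\<Phi> k) (\<Lambda> k) (vu k) (vl k) (w k)"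
    by metis
  have "\<exists>r. r \<in> R \<and> supports R (w k) r \<and>
      \<Phi> (Suc k) = insert r (\<Phi> k) \<and> \<Lambda> (Suc k) = insert (w k, r) (\<Lambda> k)" for k
  proof -
    obtain r where r: "r \<in> R" "supports R (w k) r" and
      "c (Suc (2 * k)) = Refine (insert r (\<Phi> k)) (insert (w k, r) (\<Lambda> k)) (vu k) (vl k) (w k) r"
      using step[of "2 * k"] query[of k] by (auto elim: cq_step.cases)
    then have "\<Phi> (Suc k) = insert r (\<Phi> k) \<and> \<Lambda> (Suc k) = insert (w k, r) (\<Lambda> k)"
      using step[of "Suc (2 * k)"] query[of "Suc k"] by (auto elim: cq_step.cases)
    with r show ?thesis
      by blast
  qed
  then obtain r where r: "\<And>k. r k \<in> R" "\<And>k. supports R (w k) (r k)"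
    and Suc: "\<And>k. \<Phi> (Suc k) = insert (r k) (\<Phi> k)" "\<And>k. \<Lambda> (Suc k) = insert (w k, r k) (\<Lambda> k)"
    by metis
  have recorded: "r j \<in> \<Phi> k" "(w j, r j) \<in> \<Lambda> k" if "j < k" for j k
    using that by (induction k) (auto simp: Suc less_Suc_eq)
  define F where "F k = R \<inter> {x. w k \<bullet> x = w k \<bullet> r k}" for k
  have "F k face_of R" for k
    unfolding F_def using \<open>convex R\<close> r(2)
    by (intro face_of_Int_supporting_hyperplane_le) (auto simp: supports_def)
  then have "finite (range F)"
    by (intro finite_subset[OF _ finite_polytope_faces[OF assms(1)]]) auto
  then obtain k0 where inf: "infinite {k. F k = F k0}"
    using pigeonhole_infinite[of UNIV F] by auto
  have not_acute: "w k \<noteq> 0 \<and> w j \<bullet> w k \<le> 0" if "j < k" "F j = F k0" "F k = F k0" for j k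
  proof -
    have *: "cq_invariant R B f \<epsilon> (Query (\<Phi> k) (\<Lambda> k) (vu k) (vl k) (w k))"
      using inv[of "2 * k"] by (simp only: query)
    have "F j = F k"
      using that by simp
    from same_face_imp_not_acute[OF * \<open>convex R\<close> recorded[OF that(1)] r(2) this[unfolded F_def]]
    show ?thesis
      by blast
  qed
  \<comment> \<open>Each remaining index has the earlier index \<open>k0\<close> with the same face,
    which yields \<open>w k \<noteq> 0\<close>.\<close>
  have "infinite ({k. F k = F k0} - {..k0})"
    using inf by (simp add: Diff_infinite_finite)
  moreover have "w k \<noteq> 0" if "k \<in> {k. F k = F k0} - {..k0}" for k
    using not_acute[of k0 k] that by auto
  ultimately obtain j k where "j < k" "F j = F k0" "F k = F k0" "w j \<bullet> w k > 0"
    using infinite_exists_acute_pair[of "{k. F k = F k0} - {..k0}" w] by auto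
  then show False
    using not_acute by force
qed

section \<open>Termination and correctness of maximal runs\<close>

theorem theorem4p4:
  fixes M :: "('s::finite, 'a::finite) mdp"
    and \<rho> :: "'m::finite \<Rightarrow> 's \<Rightarrow> 'a \<Rightarrow> rat"
    and l u :: "ereal ^ 'm"
    and f :: "real ^ 'm \<Rightarrow> real"
    and \<epsilon> :: real
    and c :: "nat \<Rightarrow> (real ^ 'm) config"
  assumes mdp: "is_mdp M"
    and rewards_nonneg: "\<And>i s a. \<rho> i s a \<ge> 0"
    and rewards_finite: "\<And>i \<pi>. \<pi> \<in> schedulers M \<Longrightarrow> total_reward M (\<rho> i) \<pi> < \<infinity>"
    and achievable_polytope: "polytope (achievable M \<rho>)"
    and box: "\<And>i. l $ i \<noteq> \<infinity> \<and> u $ i \<noteq> -\<infinity>"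
    and f_convex: "convex_on UNIV f"
    and f_gradient: "\<exists>g. (\<forall>x. GDERIV f x :> g x) \<and> continuous_on UNIV g"
    and eps: "\<epsilon> \<ge> 0"
    and run: "cq_run (achievable M \<rho>) (ebox l u) f \<epsilon> c"
    and arg_min_defined: "minimizers_exist (ebox l u) f c"
  shows "(\<exists>n. c n = Infeasible \<or> (\<exists>v. c n = Solution v)) \<and>
    ((\<exists>n. c n = Infeasible) \<longleftrightarrow> achievable M \<rho> \<inter> ebox l u = {}) \<and>
    (\<forall>v. (\<exists>n. c n = Solution v) \<longrightarrow>
      (\<exists>x. is_arg_min f (\<lambda>x. x \<in> achievable M \<rho> \<inter> ebox l u) x \<and> f x \<le> f v \<and> f v \<le> f x + \<epsilon>))"
proof -
  define R B where "R = achievable M \<rho>" and "B = ebox l u"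
  have R: "polytope R" "compact R" "convex R" "R \<noteq> {}"
    using achievable_polytope
    by (auto simp: R_def achievable_nonempty polytope_imp_compact polytope_imp_convex)
  note run = run[folded R_def B_def] and arg_min_defined = arg_min_defined[folded B_def]
  have inv: "cq_invariant R B f \<epsilon> (c n)" for n
    using R(3) eps run by (rule cq_invariant_run)
  have terminates: "\<exists>n. c n = Infeasible \<or> (\<exists>v. c n = Solution v)"
  proof (rule ccontr)
    assume "\<not> ?thesis"
    \<comment> \<open>A run that never stops is never stuck either, so all its transitions are
      proper steps.\<close>
    then have "\<exists>c'. cq_step R B f \<epsilon> (c n) c'" for n
      using arg_min_defined unfolding minimizers_exist_def
      by (intro cq_step_exists[OF R(2,4) inv]) blast+
    then have "cq_step R B f \<epsilon> (c n) (c (Suc n))" for n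
      using run unfolding cq_run_def by blast
    then show False
      using no_infinite_execution[OF R(1) eps] run unfolding cq_run_def by blast
  qed
  have infeasible: "R \<inter> B = {}" if "c n = Infeasible" for n
    using inv[of n] that by simp
  have solution: "v \<in> R \<inter> B" "\<forall>x\<in>R \<inter> B. f v \<le> f x + \<epsilon>" if "c n = Solution v" for n v
    using inv[of n] that by simp_all
  have "compact (R \<inter> B)"
    unfolding B_def by (intro compact_Int_closed R(2) closed_ebox)
  \<comment> \<open>Convexity on the whole space gives continuity, so the minimum over the compact
    set is attained once a solution shows that the set is non-empty.\<close>
  moreover have "continuous_on (R \<inter> B) f"
    using convex_on_continuous[OF open_UNIV f_convex] continuous_on_subset by blast
  ultimately have "\<exists>x. is_arg_min f (\<lambda>x. x \<in> R \<inter> B) x \<and> f x \<le> f v \<and> f v \<le> f x + \<epsilon>"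
    if "c n = Solution v" for n v
    using compact_is_arg_min_exists[of "R \<inter> B" f] solution[OF that]
    by (auto simp: is_arg_min_linorder)
  \<comment> \<open>If \<open>R \<inter> B\<close> is empty, no solution can be returned, so
    termination leaves only \<open>Infeasible\<close>.\<close>
  moreover have "(\<exists>n. c n = Infeasible) \<longleftrightarrow> R \<inter> B = {}"
    using terminates infeasible solution(1) by blast
  ultimately show ?thesis
    using terminates unfolding R_def B_def by blast
qed

end
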